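(* Let $n\ge1$. For all $A\in M_n(\mathbb{C})$, $$\det(A)=L_\phi(M_\phi(A)).$$
   Context: Let $\omega=e^{2\pi i/n}$, let $S_n$ be the symmetric group on $\{1,\dots,n\}$ with composition $(\sigma\circ\tau)(i)=\sigma(\tau(i))$, let $\varepsilon(\sigma)$ be the sign of $\sigma$, and let $\rho=(1\,2\,\cdots\,n)$ be the cycle $\rho(i)=i+1$ for $i<n$, $\rho(n)=1$. Each orbit $\{\sigma\circ\rho^r: r\in\mathbb{Z}/n\mathbb{Z}\}$ contains exactly one permutation $\sigma^*$ with $\sigma^*(1)=1$. The orbital phase $\phi:S_n\to\mathbb{Z}/n\mathbb{Z}$ is the unique function such that $\phi(\sigma^*\circ\rho^r)=r$ for every $\sigma^*\in S_n$ with $\sigma^*(1)=1$ and every $r\in\mathbb{Z}/n\mathbb{Z}$. For $A=(a_{ij})\in M_n(\mathbb{C})$ put $m_\sigma(A)=\varepsilon(\sigma)\prod_{i=1}^n a_{i,\sigma(i)}$. Let $V=\mathbb{C}^{S_n}$ be the space of functions $S_n\to\mathbb{C}$ with canonical basis $\{\delta_\sigma\}$, $\delta_\sigma(\tau)=1$ if $\tau=\sigma$ and $0$ otherwise. The phased monomial vector is $M_\phi(A)=\sum_{\sigma\in S_n}m_\sigma(A)\,\omega^{\phi(\sigma)}\,\delta_\sigma\in V$. The readout functional is the linear map $L_\phi:V\to\mathbb{C}$, $L_\phi(f)=\sum_{\sigma\in S_n}\omega^{-\phi(\sigma)}f(\sigma)$. *)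

theory Defs
  imports
    Complex_Main
    "HOL-Library.FuncSet"
    "HOL-Combinatorics.Permutations"
    "Jordan_Normal_Form.Determinant"
begin

definition sym_perms :: "nat \<Rightarrow> (nat \<Rightarrow> nat) set"
  where "sym_perms n = {\<sigma>. \<sigma> permutes {1..n}}"

definition omega :: "nat \<Rightarrow> complex"
  where "omega n = exp (2 * of_real pi * \<i> / of_nat n)"

definition rho :: "nat \<Rightarrow> nat \<Rightarrow> nat"
  where "rho n i = (if 1 \<le> i \<and> i < n then i + 1 else if i = n then 1 else i)"

text \<open>
  Elements of the integers modulo n are represented by their residues in \<open>{..<n}\<close>; this is
  compatible with powers of \<open>rho n\<close> and of \<open>omega n\<close>, whose n-th powers are trivial.
  Outside of \<open>sym_perms n\<close> the phase is \<open>undefined\<close> (extensionality), so that the description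
  below determines a unique HOL function, see \<open>ex1_orbital_phase\<close>.
\<close>

definition is_orbital_phase :: "nat \<Rightarrow> ((nat \<Rightarrow> nat) \<Rightarrow> nat) \<Rightarrow> bool"
  where "is_orbital_phase n \<phi> \<longleftrightarrow>
    \<phi> \<in> sym_perms n \<rightarrow>\<^sub>E {..<n} \<and>
    (\<forall>\<sigma>\<in>sym_perms n. \<sigma> 1 = 1 \<longrightarrow> (\<forall>r<n. \<phi> (\<sigma> \<circ> (rho n ^^ r)) = r))"

definition orbital_phase :: "nat \<Rightarrow> (nat \<Rightarrow> nat) \<Rightarrow> nat"
  where "orbital_phase n = (THE \<phi>. is_orbital_phase n \<phi>)"

text \<open>Library matrices are indexed from 0, permutations here act on \<open>{1..n}\<close>; hence the shift.\<close>

definition monomial_term :: "nat \<Rightarrow> (nat \<Rightarrow> nat) \<Rightarrow> complex mat \<Rightarrow> complex"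
  where "monomial_term n \<sigma> A = of_int (sign \<sigma>) * (\<Prod>i=1..n. A $$ (i - 1, \<sigma> i - 1))"

text \<open>
  The complex functions on \<open>sym_perms n\<close> are represented by the functions that vanish
  outside of \<open>sym_perms n\<close>, with pointwise operations.
\<close>

definition fun_space :: "nat \<Rightarrow> ((nat \<Rightarrow> nat) \<Rightarrow> complex) set"
  where "fun_space n = {f. \<forall>\<sigma>. \<sigma> \<notin> sym_perms n \<longrightarrow> f \<sigma> = 0}"

definition delta :: "(nat \<Rightarrow> nat) \<Rightarrow> (nat \<Rightarrow> nat) \<Rightarrow> complex"
  where "delta \<sigma> \<tau> = (if \<tau> = \<sigma> then 1 else 0)"

definition phased_monomial_vector :: "nat \<Rightarrow> complex mat \<Rightarrow> (nat \<Rightarrow> nat) \<Rightarrow> complex"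
  where "phased_monomial_vector n A =
    (\<lambda>\<tau>. \<Sum>\<sigma>\<in>sym_perms n. monomial_term n \<sigma> A * omega n ^ orbital_phase n \<sigma> * delta \<sigma> \<tau>)"

definition readout :: "nat \<Rightarrow> ((nat \<Rightarrow> nat) \<Rightarrow> complex) \<Rightarrow> complex"
  where "readout n f = (\<Sum>\<sigma>\<in>sym_perms n. omega n powi (- int (orbital_phase n \<sigma>)) * f \<sigma>)"


lemma phased_monomial_vector_in_fun_space: "phased_monomial_vector n A \<in> fun_space n"
  unfolding fun_space_def phased_monomial_vector_def delta_def
  by (auto intro!: sum.neutral)

lemma readout_add: "readout n (\<lambda>\<sigma>. f \<sigma> + g \<sigma>) = readout n f + readout n g"
  by (simp add: readout_def algebra_simps sum.distrib)

lemma readout_scale: "readout n (\<lambda>\<sigma>. c * f \<sigma>) = c * readout n f"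
  by (simp add: readout_def sum_distrib_left mult_ac)

lemma rho_permutes:
  assumes "1 \<le> n"
  shows "rho n permutes {1..n}"
proof (rule bij_imp_permutes)
  have "inj_on (rho n) {1..n}"
    by (auto simp: inj_on_def rho_def split: if_splits)
  moreover have "rho n ` {1..n} \<subseteq> {1..n}"
    using assms by (auto simp: rho_def)
  ultimately show "bij_betw (rho n) {1..n} {1..n}"
    by (simp add: bij_betw_def endo_inj_surj)
qed (use assms in \<open>auto simp: rho_def\<close>)

lemma rho_pow_permutes:
  assumes "1 \<le> n"
  shows "(rho n ^^ r) permutes {1..n}"
proof (induction r)
  case 0
  then show ?case by (simp add: permutes_def)
next
  case (Suc r)
  then show ?case using permutes_compose[OF Suc rho_permutes[OF assms]] by (simp only: funpow.simps)
qed

lemma rho_pow_apply: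
  assumes "1 \<le> i" "i \<le> n"
  shows "(rho n ^^ r) i = (i - 1 + r) mod n + 1"
proof (induction r)
  case 0
  then show ?case using assms by simp
next
  case (Suc r)
  have "(i - 1 + r) mod n < n" using assms by simp
  moreover have "(i - 1 + Suc r) mod n =
      (if Suc ((i - 1 + r) mod n) = n then 0 else Suc ((i - 1 + r) mod n))"
    by (simp only: add_Suc_right mod_Suc)
  moreover have "(rho n ^^ Suc r) i = rho n ((i - 1 + r) mod n + 1)"
    using Suc by simp
  moreover have "rho n ((i - 1 + r) mod n + 1) =
      (if Suc ((i - 1 + r) mod n) = n then 0 else Suc ((i - 1 + r) mod n)) + 1"
    using \<open>(i - 1 + r) mod n < n\<close> by (auto simp: rho_def)
  ultimately show ?case by (simp only:)
qed

lemma rho_pow_eq_1_iff: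
  assumes "1 \<le> i" "i \<le> n" "r < n"
  shows "(rho n ^^ r) i = 1 \<longleftrightarrow> r = (n + 1 - i) mod n"
proof (cases "i = 1")
  case True
  then show ?thesis using assms by (simp add: rho_pow_apply)
next
  case False
  have *: "(i - 1 + r) mod n = (if i - 1 + r < n then i - 1 + r else i - 1 + r - n)"
    using assms by (simp add: mod_if)
  have "(n + 1 - i) mod n = n + 1 - i" using assms False by simp
  then show ?thesis
    unfolding rho_pow_apply[OF assms(1,2)] * using assms False by (auto split: if_splits)
qed

lemma ex1_orbital_phase:
  assumes "1 \<le> n"
  shows "\<exists>!\<phi>. is_orbital_phase n \<phi>"
proof
  define p where
    "p = (\<lambda>\<sigma>\<in>sym_perms n. (n + 1 - Hilbert_Choice.inv \<sigma> 1) mod n)"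
  show "is_orbital_phase n p"
    unfolding is_orbital_phase_def
  proof (intro conjI ballI impI allI)
    show "p \<in> sym_perms n \<rightarrow>\<^sub>E {..<n}" using assms by (auto simp: p_def)
    fix \<sigma> r assume s: "\<sigma> \<in> sym_perms n" "\<sigma> 1 = 1" and r: "r < n"
    define t where "t = \<sigma> \<circ> (rho n ^^ r)"
    have t: "t permutes {1..n}"
      using s rho_pow_permutes[OF assms] by (auto simp: t_def sym_perms_def intro: permutes_compose)
    define i where "i = Hilbert_Choice.inv t 1"
    have ti: "t i = 1" using permutes_inverses(1)[OF t] by (simp add: i_def)
    have i: "i \<in> {1..n}" using permutes_in_image[OF t, of i] ti assms by simp
    have "(rho n ^^ r) i = 1"
      using ti s permutes_inj[of \<sigma> "{1..n}"] unfolding t_def sym_perms_def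
      by (metis comp_apply injD mem_Collect_eq)
    then have "r = (n + 1 - i) mod n" using rho_pow_eq_1_iff[of i n r] i r by simp
    then show "p (\<sigma> \<circ> (rho n ^^ r)) = r"
      using t by (simp add: p_def sym_perms_def i_def t_def)
  qed
  fix q assume q: "is_orbital_phase n q"
  have "q \<tau> = p \<tau>" if "\<tau> \<in> sym_perms n" for \<tau>
  proof -
    have t: "\<tau> permutes {1..n}" using that by (simp add: sym_perms_def)
    define i where "i = Hilbert_Choice.inv \<tau> 1"
    define r where "r = (n + 1 - i) mod n"
    define \<sigma> where "\<sigma> = \<tau> \<circ> Hilbert_Choice.inv (rho n ^^ r)"
    have ti: "\<tau> i = 1" using permutes_inverses(1)[OF t] by (simp add: i_def)
    have i: "i \<in> {1..n}" using permutes_in_image[OF t, of i] ti assms by simp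
    have r: "r < n" using assms by (simp add: r_def)
    note P = rho_pow_permutes[OF assms, of r]
    have ri: "(rho n ^^ r) i = 1" using rho_pow_eq_1_iff[of i n r] i r by (simp add: r_def)
    have "Hilbert_Choice.inv (rho n ^^ r) 1 = i" using permutes_inverses(2)[OF P, of i] ri by simp
    then have 1: "\<sigma> 1 = 1" using ti by (simp add: \<sigma>_def)
    have 2: "\<sigma> \<in> sym_perms n"
      using t permutes_inv[OF P] by (auto simp: \<sigma>_def sym_perms_def intro: permutes_compose)
    have 3: "\<sigma> \<circ> (rho n ^^ r) = \<tau>"
      by (rule ext) (simp add: \<sigma>_def permutes_inverses(2)[OF P])
    have "q \<tau> = r" using q 1 2 r unfolding is_orbital_phase_def by (metis 3)
    then show ?thesis using that by (simp add: p_def r_def i_def)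
  qed
  moreover have "q \<in> extensional (sym_perms n)" "p \<in> extensional (sym_perms n)"
    using q by (auto simp: is_orbital_phase_def p_def PiE_def)
  ultimately show "q = p" by (meson extensionalityI)
qed

lemma orbital_phase: "1 \<le> n \<Longrightarrow> is_orbital_phase n (orbital_phase n)"
  unfolding orbital_phase_def by (rule theI'[OF ex1_orbital_phase])

end

theory Submission
  imports Defs
begin

text \<open>
  The phase cancels term by term: the coordinate of the phased monomial vector at \<open>\<sigma>\<close> carries
  the factor \<open>\<omega>\<^bsup>\<phi>(\<sigma>)\<^esup>\<close>, the readout multiplies it by \<open>\<omega>\<^bsup>-\<phi>(\<sigma>)\<^esup>\<close>, and \<open>\<omega> \<noteq> 0\<close>. What
  remains is the Leibniz sum over the permutations of \<open>{1..n}\<close>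
  (\<open>readout_phased_monomial_vector\<close>). It equals the determinant,
  which is a Leibniz sum over the permutations of \<open>{0..<n}\<close>, because conjugation by the
  successor is a sign-preserving bijection between the two groups that matches the Leibniz
  terms (\<open>bij_betw_map_permutation_Suc\<close>, \<open>monomial_term_map_permutation_Suc\<close>).
\<close>

lemma readout_phased_monomial_vector:
  "readout n (phased_monomial_vector n A) = (\<Sum>\<sigma>\<in>sym_perms n. monomial_term n \<sigma> A)"
proof -
  have fin: "finite (sym_perms n)"
    by (simp add: sym_perms_def finite_permutations)
  have "phased_monomial_vector n A \<sigma> = monomial_term n \<sigma> A * omega n ^ orbital_phase n \<sigma>"
    if "\<sigma> \<in> sym_perms n" for \<sigma>
    using that fin by (simp add: phased_monomial_vector_def delta_def if_distrib cong: if_cong)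
  moreover have "omega n \<noteq> 0"
    by (simp add: omega_def)
  ultimately show ?thesis
    by (auto simp: readout_def power_int_minus field_simps intro!: sum.cong)
qed

text \<open>
  \<open>map_permutation {0..<n} Suc\<close> is conjugation by the successor, and conjugation by the
  predecessor undoes it.
\<close>

lemma bij_betw_map_permutation_Suc:
  "bij_betw (map_permutation {0..<n} Suc) {p. p permutes {0..<n}} (sym_perms n)"
proof -
  have image_Suc: "bij_betw Suc {0..<n} {1..n}"
    by (simp add: bij_betw_def image_Suc_atLeastLessThan atLeastLessThanSuc_atLeastAtMost)
  have image_pred: "bij_betw (\<lambda>i. i - 1) {1..n} {0..<n}"
    by (rule bij_betw_byWitness[where f' = Suc]) auto
  show ?thesis
    unfolding sym_perms_def
  proof (rule bij_betw_byWitness[where f' = "map_permutation {1..n} (\<lambda>i. i - 1)"])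
    show "\<forall>p\<in>{p. p permutes {0..<n}}.
        map_permutation {1..n} (\<lambda>i. i - 1) (map_permutation {0..<n} Suc p) = p"
      using map_permutation_compose_inv[OF image_Suc] by auto
    show "\<forall>\<sigma>\<in>{\<sigma>. \<sigma> permutes {1..n}}.
        map_permutation {0..<n} Suc (map_permutation {1..n} (\<lambda>i. i - 1) \<sigma>) = \<sigma>"
      using map_permutation_compose_inv[OF image_pred] by auto
  qed (use map_permutation_permutes image_Suc image_pred in blast)+
qed

lemma monomial_term_map_permutation_Suc:
  assumes "p permutes {0..<n}"
  shows "monomial_term n (map_permutation {0..<n} Suc p) A =
    of_int (sign p) * (\<Prod>i = 0..<n. A $$ (i, p i))"
proof -
  have "(\<Prod>i=1..n. A $$ (i - 1, map_permutation {0..<n} Suc p i - 1)) =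
      (\<Prod>i = 0..<n. A $$ (i, map_permutation {0..<n} Suc p (Suc i) - 1))"
    by (rule prod.reindex_bij_witness[of _ Suc "\<lambda>i. i - 1"]) auto
  also have "\<dots> = (\<Prod>i = 0..<n. A $$ (i, p i))"
    by (simp add: map_permutation_apply)
  finally show ?thesis
    using assms by (simp add: monomial_term_def sign_map_permutation)
qed

theorem theorem2p5:
  fixes n :: nat and A :: "complex mat"
  assumes "n \<ge> 1"
    and "A \<in> carrier_mat n n"
  shows "det A = readout n (phased_monomial_vector n A)"
proof -
  have "det A = (\<Sum>p | p permutes {0..<n}. monomial_term n (map_permutation {0..<n} Suc p) A)"
    by (simp add: det_def'[OF assms(2)] monomial_term_map_permutation_Suc)
  also have "\<dots> = (\<Sum>\<sigma>\<in>sym_perms n. monomial_term n \<sigma> A)"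
    by (rule sum.reindex_bij_betw[OF bij_betw_map_permutation_Suc])
  also have "\<dots> = readout n (phased_monomial_vector n A)"
    by (rule readout_phased_monomial_vector[symmetric])
  finally show ?thesis .
qed

end
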